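(* Let $0.4302 \le \lambda < 1/2$ and let $$C_\lambda=\Big\{(1-\lambda)\sum_{i=1}^\infty d_i\lambda^{i-1} : d_i\in\{0,1\}\Big\}.$$ Then for every $t\in(0,1)$ the set $$S_t=\{(x,y)\in C_\lambda\times C_\lambda : xy=t\}$$ has the cardinality of the continuum.
   Context: For $\lambda\in(0,1/2)$, $C_\lambda$ is the middle Cantor set with convex hull $[0,1]$; equivalently it is the unique nonempty compact set with $C_\lambda=\varphi_0(C_\lambda)\cup\varphi_1(C_\lambda)$, where $\varphi_i(x)=\lambda x+i(1-\lambda)$, $i=0,1$. *)

theory Defs
  imports "HOL-Analysis.Analysis" "HOL-Library.Equipollence"
begin

text \<open>
  The digits are indexed from \<open>0\<close>, so \<open>d i\<close> is the digit usually written \<open>d\<^sub>i\<^sub>+\<^sub>1\<close>.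
  The series converges for \<open>\<bar>r\<bar> < 1\<close>; otherwise \<open>suminf\<close> may be an unspecified value.
\<close>

definition middle_cantor :: "real \<Rightarrow> real set" where
  "middle_cantor r = {(1 - r) * (\<Sum>i. d i * r ^ i) | d :: nat \<Rightarrow> real. \<forall>i. d i \<in> {0, 1}}"

end

theory Submission
  imports Defs
begin

text \<open>
  Call a pair of level-\<open>n\<close> construction intervals \<open>[a, a + r\<^sup>n]\<close>, \<open>[c, c + r\<^sup>n]\<close> inside
  \<open>[1 - r, 1]\<close> \<^emph>\<open>straddling\<close> if \<open>a c < t < (a + r\<^sup>n) (c + r\<^sup>n)\<close>.  The product images of the four
  subsquares of a straddling square overlap so much that \<open>t\<close> lies in the interior of two of them,
  unless \<open>t\<close> is close to one of the extreme values \<open>a c\<close>, \<open>(a + r\<^sup>n) (c + r\<^sup>n)\<close>.  In that case one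
  passes to ever smaller subsquares at the corresponding corner; as the inner region is long compared
  with the factor \<open>r\<close>, the point \<open>t\<close> must hit it.  So every straddling square contains two disjoint
  straddling squares, and the solutions of \<open>x y = t\<close> contain a binary tree of compact sets.
  Since \<open>(1 - r)\<^sup>2 < r\<close>, every \<open>t\<close> in \<open>(0, 1)\<close> is \<open>r\<^sup>k\<close> times a value straddled by \<open>[1 - r, 1]\<^sup>2\<close>.
\<close>

section \<open>Cantor schemes of compact sets\<close>

text \<open>Each set of naturals steers a branch of nested nonempty compact sets and so selects a
  point of \<open>K\<close>. Branches that part ways enter disjoint sets, so the selection is
  injective.\<close>

lemma lepoll_compact_splitting:
  fixes \<K> :: "'a::heine_borel set set"
  assumes compact: "\<And>K. K \<in> \<K> \<Longrightarrow> compact K" and nonempty: "\<And>K. K \<in> \<K> \<Longrightarrow> K \<noteq> {}"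
    and split: "\<And>K. K \<in> \<K> \<Longrightarrow> \<exists>K1\<in>\<K>. \<exists>K2\<in>\<K>. K1 \<subseteq> K \<and> K2 \<subseteq> K \<and> K1 \<inter> K2 = {}"
    and K: "K \<in> \<K>"
  shows "(UNIV :: real set) \<lesssim> K"
proof -
  have "\<forall>K. \<exists>K1 K2. K \<in> \<K> \<longrightarrow>
      K1 \<in> \<K> \<and> K2 \<in> \<K> \<and> K1 \<subseteq> K \<and> K2 \<subseteq> K \<and> K1 \<inter> K2 = {}"
    using split by meson
  then obtain f g where fg: "\<And>K. K \<in> \<K> \<Longrightarrow>
      f K \<in> \<K> \<and> g K \<in> \<K> \<and> f K \<subseteq> K \<and> g K \<subseteq> K \<and> f K \<inter> g K = {}"
    by metis
  define F where "F b K = (if b then f K else g K)" for b K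
  have F: "F b K \<in> \<K>" "F b K \<subseteq> K" if "K \<in> \<K>" for b K
    using fg that by (auto simp: F_def)
  have F_disjoint: "F b K \<inter> F b' K = {}" if "K \<in> \<K>" "b \<noteq> b'" for b b' K
    using fg[OF that(1)] that(2) by (cases b; cases b'; simp add: F_def Int_commute)
  define T where "T N = rec_nat K (\<lambda>k. F (k \<in> N))" for N :: "nat set"
  have T_simps: "T N 0 = K" "T N (Suc k) = F (k \<in> N) (T N k)" for N k
    by (simp_all add: T_def)
  have T_in: "T N k \<in> \<K>" for N k
    by (induction k) (auto simp: T_simps K F)
  have T_Suc: "T N (Suc k) \<subseteq> T N k" for N k
    using F T_in by (simp add: T_simps)
  have T_mono: "T N l \<subseteq> T N k" if "k \<le> l" for N k l
    using lift_Suc_antimono_le[of "T N", OF T_Suc that] .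
  have "(\<Inter>k. T N k) \<noteq> {}" for N
    using compact[OF T_in] nonempty[OF T_in] T_mono by (rule compact_nest)
  then have "\<forall>N. \<exists>x. \<forall>k. x \<in> T N k"
    by blast
  then obtain x where x: "\<And>N k. x N \<in> T N k"
    using choice[of "\<lambda>N x. \<forall>k. x \<in> T N k"] by blast
  have "inj x"
  proof (rule injI, rule ccontr)
    fix M N assume eq: "x M = x N" and "M \<noteq> N"
    then have "\<exists>k. (k \<in> M) \<noteq> (k \<in> N)" by blast
    \<comment> \<open>At the least index of disagreement both branches still sit at the same set,
      and they enter its two disjoint parts.\<close>
    then obtain k where k: "(k \<in> M) \<noteq> (k \<in> N)" and least: "\<And>j. j < k \<Longrightarrow> (j \<in> M) = (j \<in> N)"
      using exists_least_iff[of "\<lambda>k. (k \<in> M) \<noteq> (k \<in> N)"] by blast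
    have "j \<le> k \<Longrightarrow> T M j = T N j" for j
      by (induction j) (auto simp: T_simps least)
    then have "T M k = T N k" by simp
    then have "T M (Suc k) \<inter> T N (Suc k) = {}"
      using F_disjoint[OF T_in k, of N k] by (simp add: T_simps)
    then show False
      using x eq by (metis IntI empty_iff)
  qed
  moreover have "range x \<subseteq> K"
    using x T_simps(1) by blast
  ultimately have "(UNIV :: nat set set) \<lesssim> K"
    by (auto simp: lepoll_def)
  with eqpoll_imp_lepoll[OF eqpoll_sym[OF nat_sets_eqpoll_reals]] show ?thesis
    by (rule lepoll_trans)
qed

section \<open>Middle Cantor sets\<close>

lemma compact_binary_sequences: "compact {d :: nat \<Rightarrow> real. \<forall>i. d i \<in> {0, 1}}"
proof -
  have "compactin (product_topology (\<lambda>i. euclidean) UNIV) (PiE UNIV (\<lambda>i::nat. {0, 1::real}))"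
    by (subst compactin_PiE) auto
  moreover have "PiE UNIV (\<lambda>i::nat. {0, 1::real}) = {d. \<forall>i. d i \<in> {0, 1}}"
    by (auto simp: PiE_def Pi_def)
  ultimately show ?thesis
    by (simp add: euclidean_product_topology compactin_euclidean_iff)
qed

lemma norm_digit_le:
  fixes r :: real
  assumes "0 < r" "d i \<in> {0, 1 :: real}"
  shows "norm (d i * r ^ i) \<le> r ^ i"
  using assms by auto

lemma summable_digits:
  fixes r :: real
  assumes "0 < r" "r < 1" "\<forall>i. d i \<in> {0, 1 :: real}"
  shows "summable (\<lambda>i. d i * r ^ i)"
proof (rule summable_comparison_test')
  show "summable (\<lambda>i. r ^ i)" using assms by simp
  show "norm (d i * r ^ i) \<le> r ^ i" if "0 \<le> i" for i
    using assms norm_digit_le by blast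
qed

text \<open>The digit space is compact by Tychonoff, and the digit series is continuous on it as a
  uniform limit of continuous partial sums.\<close>

lemma compact_middle_cantor:
  assumes "0 < r" "r < 1"
  shows "compact (middle_cantor r)"
proof -
  let ?D = "{d :: nat \<Rightarrow> real. \<forall>i. d i \<in> {0, 1}}"
  have "uniform_limit ?D (\<lambda>n d. \<Sum>i<n. d i * r ^ i) (\<lambda>d. \<Sum>i. d i * r ^ i) sequentially"
  proof (rule Weierstrass_m_test)
    show "summable (\<lambda>i. r ^ i)" using assms by simp
    show "norm (d i * r ^ i) \<le> r ^ i" if "d \<in> ?D" for i and d :: "nat \<Rightarrow> real"
      using assms that norm_digit_le by blast
  qed
  then have "continuous_on ?D (\<lambda>d. \<Sum>i. d i * r ^ i)"
    by (rule uniform_limit_theorem[rotated])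
      (auto intro!: always_eventually continuous_intros
        intro: continuous_on_subset[OF continuous_on_product_coordinates])
  then have "continuous_on ?D (\<lambda>d. (1 - r) * (\<Sum>i. d i * r ^ i))"
    by (intro continuous_intros)
  then have "compact ((\<lambda>d. (1 - r) * (\<Sum>i. d i * r ^ i)) ` ?D)"
    using compact_binary_sequences compact_continuous_image by blast
  moreover have "(\<lambda>d. (1 - r) * (\<Sum>i. d i * r ^ i)) ` ?D = middle_cantor r"
    by (auto simp: middle_cantor_def)
  ultimately show ?thesis by simp
qed

text \<open>Prepending the digit 0 to an expansion multiplies its value by \<open>r\<close>.\<close>

lemma middle_cantor_scale:
  assumes "0 < r" "r < 1" "x \<in> middle_cantor r"
  shows "r * x \<in> middle_cantor r"
proof -
  obtain d where d: "\<forall>i. d i \<in> {0, 1}" "x = (1 - r) * (\<Sum>i. d i * r ^ i)"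
    using assms(3) by (auto simp: middle_cantor_def)
  define e where "e i = (case i of 0 \<Rightarrow> 0 | Suc j \<Rightarrow> d j)" for i
  have e: "\<forall>i. e i \<in> {0, 1}"
    using d(1) by (auto simp: e_def split: nat.split)
  have "(\<Sum>i. e i * r ^ i) = (\<Sum>i. e (Suc i) * r ^ Suc i) + e 0 * r ^ 0"
    using suminf_split_head[OF summable_digits[OF assms(1,2) e]] by simp
  also have "\<dots> = (\<Sum>i. r * (d i * r ^ i))"
    by (simp add: e_def mult_ac)
  also have "\<dots> = r * (\<Sum>i. d i * r ^ i)"
    using suminf_mult[OF summable_digits[OF assms(1,2) d(1)]] .
  finally have "r * x = (1 - r) * (\<Sum>i. e i * r ^ i)"
    using d(2) by simp
  then show ?thesis
    using e by (auto simp: middle_cantor_def)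
qed

lemma middle_cantor_scale_power:
  assumes "0 < r" "r < 1" "x \<in> middle_cantor r"
  shows "r ^ k * x \<in> middle_cantor r"
  using assms by (induction k) (auto simp: middle_cantor_scale mult.assoc)

text \<open>\<open>basic_left r n a\<close>: \<open>a\<close> is the left endpoint of one of the \<open>2\<^sup>n\<close> intervals of length \<open>r\<^sup>n\<close> in
  the \<open>n\<close>-th step of the construction.\<close>

inductive basic_left :: "real \<Rightarrow> nat \<Rightarrow> real \<Rightarrow> bool" for r where
  zero: "basic_left r 0 0"
| left: "basic_left r n a \<Longrightarrow> basic_left r (Suc n) a"
| right: "basic_left r n a \<Longrightarrow> basic_left r (Suc n) (a + (1 - r) * r ^ n)"

lemma basic_left_digits:
  assumes "basic_left r n a"
  shows "\<exists>d. (\<forall>i. d i \<in> {0, 1 :: real}) \<and> (\<forall>i\<ge>n. d i = 0) \<and> a = (1 - r) * (\<Sum>i<n. d i * r ^ i)"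
  using assms
proof induction
  case zero
  show ?case by (auto intro!: exI[of _ "\<lambda>_. 0"])
next
  case (left n a)
  then obtain d where "\<forall>i. d i \<in> {0, 1 :: real}" "\<forall>i\<ge>n. d i = 0" "a = (1 - r) * (\<Sum>i<n. d i * r ^ i)"
    by blast
  then show ?case by (intro exI[of _ d]) auto
next
  case (right n a)
  then obtain d where d: "\<forall>i. d i \<in> {0, 1 :: real}" "\<forall>i\<ge>n. d i = 0" "a = (1 - r) * (\<Sum>i<n. d i * r ^ i)"
    by blast
  have "(\<Sum>i<n. (d(n := 1)) i * r ^ i) = (\<Sum>i<n. d i * r ^ i)"
    by (intro sum.cong) auto
  then have "a + (1 - r) * r ^ n = (1 - r) * (\<Sum>i<Suc n. (d(n := 1)) i * r ^ i)"
    using d(3) by (simp add: distrib_left)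
  then show ?case
    using d(1,2) by (intro exI[of _ "d(n := 1)"]) auto
qed

lemma basic_left_in_middle_cantor:
  assumes "basic_left r n a"
  shows "a \<in> middle_cantor r"
proof -
  obtain d where d: "\<forall>i. d i \<in> {0, 1 :: real}" "\<forall>i\<ge>n. d i = 0" "a = (1 - r) * (\<Sum>i<n. d i * r ^ i)"
    using basic_left_digits[OF assms] by blast
  have "(\<Sum>i. d i * r ^ i) = (\<Sum>i<n. d i * r ^ i)"
    using d(2) by (intro suminf_finite) auto
  then show ?thesis
    using d(1,3) unfolding middle_cantor_def by (intro CollectI exI[of _ d]) simp
qed

lemma basic_left_bounds:
  assumes "basic_left r n a" "0 < r" "r < 1"
  shows "0 \<le> a \<and> a + r ^ n \<le> 1"
  using assms(1)
proof induction
  case (left n a)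
  moreover have "r ^ Suc n \<le> r ^ n"
    using assms by (intro power_decreasing) auto
  ultimately show ?case by linarith
next
  case (right n a)
  moreover have "0 \<le> (1 - r) * r ^ n"
    using assms by simp
  ultimately show ?case by (simp add: algebra_simps)
qed simp

lemma basic_left_left_corner:
  assumes "basic_left r n a"
  shows "basic_left r (n + m) a"
  using assms by (induction m) (auto intro: basic_left.intros)

text \<open>A right child keeps the right endpoint of its parent, because
  \<open>(1 - r) * r ^ k + r ^ Suc k = r ^ k\<close>.\<close>

lemma basic_left_right_corner:
  assumes "basic_left r n a"
  shows "basic_left r (n + m) (a + r ^ n - r ^ (n + m))"
proof (induction m)
  case (Suc m)
  then have "basic_left r (Suc (n + m)) (a + r ^ n - r ^ (n + m) + (1 - r) * r ^ (n + m))"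
    by (rule basic_left.right)
  then show ?case by (simp add: algebra_simps)
qed (use assms in simp)

section \<open>Straddling squares\<close>

text \<open>The bounds by \<open>1 - r\<close> keep the ratio of the coordinates under control.
  Strictness leaves \<open>t\<close> a positive distance from both corner values, so that a descent
  towards a corner stops.\<close>

definition straddle :: "real \<Rightarrow> real \<Rightarrow> nat \<Rightarrow> real \<Rightarrow> real \<Rightarrow> bool" where
  "straddle r t n a c \<longleftrightarrow> basic_left r n a \<and> basic_left r n c \<and> 1 - r \<le> a \<and> 1 - r \<le> c \<and>
     a * c < t \<and> t < (a + r ^ n) * (c + r ^ n)"

definition square :: "real \<Rightarrow> nat \<Rightarrow> real \<Rightarrow> real \<Rightarrow> (real \<times> real) set" where
  "square r n a c = {a..a + r ^ n} \<times> {c..c + r ^ n}"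

text \<open>The level \<open>m\<close> is left open because a descent towards a corner may skip many
  levels.\<close>

definition splits :: "real \<Rightarrow> real \<Rightarrow> nat \<Rightarrow> real \<Rightarrow> real \<Rightarrow> bool" where
  "splits r t n a c \<longleftrightarrow> (\<exists>m a1 c1 a2 c2. n < m \<and> straddle r t m a1 c1 \<and> straddle r t m a2 c2 \<and>
     square r m a1 c1 \<subseteq> square r n a c \<and> square r m a2 c2 \<subseteq> square r n a c \<and>
     square r m a1 c1 \<inter> square r m a2 c2 = {})"

lemma straddle_commute: "straddle r t n a c \<longleftrightarrow> straddle r t n c a"
  by (auto simp: straddle_def mult.commute)

lemma square_swap: "square r n c a = prod.swap ` square r n a c"
  by (auto simp: square_def product_swap)

lemma splits_commute:
  assumes "splits r t n a c"
  shows "splits r t n c a"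
proof -
  obtain m a1 c1 a2 c2 where *: "n < m" "straddle r t m a1 c1" "straddle r t m a2 c2"
     "square r m a1 c1 \<subseteq> square r n a c" "square r m a2 c2 \<subseteq> square r n a c"
     "square r m a1 c1 \<inter> square r m a2 c2 = {}"
    using assms unfolding splits_def by blast
  have "straddle r t m c1 a1" "straddle r t m c2 a2"
    using *(2,3) straddle_commute by blast+
  moreover have "square r m c1 a1 \<subseteq> square r n c a" "square r m c2 a2 \<subseteq> square r n c a"
    using *(4,5) by (metis image_mono square_swap)+
  moreover have "square r m c1 a1 \<inter> square r m c2 a2 = {}"
    using *(6) by (auto simp: square_def)
  ultimately show ?thesis
    unfolding splits_def using *(1) by blast
qed

lemma splits_mono:
  assumes "splits r t m a' c'" "n \<le> m" "square r m a' c' \<subseteq> square r n a c"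
  shows "splits r t n a c"
proof -
  obtain k a1 c1 a2 c2 where "m < k" "straddle r t k a1 c1" "straddle r t k a2 c2"
     "square r k a1 c1 \<subseteq> square r m a' c'" "square r k a2 c2 \<subseteq> square r m a' c'"
     "square r k a1 c1 \<inter> square r k a2 c2 = {}"
    using assms(1) unfolding splits_def by blast
  then show ?thesis
    unfolding splits_def using assms(2,3) by (meson le_less_trans subset_trans)
qed

section \<open>Splitting of straddling squares\<close>

context
  fixes r t :: real
  assumes r_ge: "0.4302 \<le> r" and r_less: "r < 1 / 2"
begin

lemma r_bounds: "0 < r" "r < 1"
  using r_ge r_less by auto

text \<open>The first two bounds make product images of subsquares overlap. The third and fourth
  make the inner region long enough at the lower and at the upper corner; the fourth is the most
  restrictive.\<close>

lemma r_quadratic: "(1 - r)\<^sup>2 < r" "1 - 2 * r < r * (1 - r)" "0 < r\<^sup>2 + 2 * r - 1" "r ^ 4 < r\<^sup>2 + 2 * r - 1"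
proof -
  have "0.4302 * 0.4302 \<le> r * r" "r * r \<le> (1/2) * (1/2)"
    using r_ge r_less by (intro mult_mono; simp)+
  then have sq: "0.185 \<le> r\<^sup>2" "r\<^sup>2 \<le> 1/4"
    by (auto simp: power2_eq_square)
  show "(1 - r)\<^sup>2 < r"
    using r_ge sq by (simp add: power2_eq_square algebra_simps)
  show "1 - 2 * r < r * (1 - r)"
    using r_ge sq by (simp add: power2_eq_square algebra_simps)
  show "0 < r\<^sup>2 + 2 * r - 1"
    using r_ge sq by simp
  define u where "u = r\<^sup>2"
  \<comment> \<open>Since 37/200 + 163/200 = 1, this reads \<open>u * u \<le> u - 0.150775\<close>,
    while \<open>2 * r - 1\<close> is at least -0.1396.\<close>
  have "0 \<le> (u - 37/200) * (163/200 - u)"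
    using sq unfolding u_def by (intro mult_nonneg_nonneg) auto
  also have "\<dots> = u - 6031/40000 - u * u"
    by algebra
  also have "u * u = r ^ 4"
    by (simp add: u_def power_add [symmetric])
  finally show "r ^ 4 < r\<^sup>2 + 2 * r - 1"
    using r_ge by (simp add: u_def)
qed

lemma square_children_subset:
  assumes "a' \<in> {a, a + (1 - r) * r ^ n}" "c' \<in> {c, c + (1 - r) * r ^ n}"
  shows "square r (Suc n) a' c' \<subseteq> square r n a c"
proof -
  have "r * r ^ n \<le> r ^ n" "0 \<le> r ^ n"
    using r_bounds by (auto simp: mult_left_le_one_le)
  then show ?thesis
    using assms by (auto simp: square_def algebra_simps)
qed

lemma square_children_disjoint:
  "square r (Suc n) a c' \<inter> square r (Suc n) (a + (1 - r) * r ^ n) c'' = {}"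
proof -
  have "r * r ^ n < (1 - r) * r ^ n"
    using r_bounds r_less by simp
  then show ?thesis
    by (auto simp: square_def)
qed

text \<open>For \<open>c \<le> a\<close> the images of the subsquares, ordered as \<open>00, 10, 01, 11\<close> (the first digit belongs
  to \<open>a\<close>), have increasing left and increasing right endpoints, and each one meets its second
  successor.  Hence the region between the left endpoint of \<open>10\<close> and the right endpoint of \<open>01\<close> is
  covered twice.\<close>

lemma splits_inner:
  assumes st: "straddle r t n a c" and "c \<le> a"
    and lower: "(a + (1 - r) * r ^ n) * c < t" and upper: "t < (a + r * r ^ n) * (c + r ^ n)"
  shows "splits r t n a c"
proof -
  define h where "h = r ^ n"
  define \<alpha> where "\<alpha> = a + (1 - r) * h"
  define \<gamma> where "\<gamma> = c + (1 - r) * h"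
  have h: "0 < h" using r_bounds by (simp add: h_def)
  have basic: "basic_left r n a" "basic_left r n c" and ac: "1 - r \<le> a" "1 - r \<le> c" "a * c < t"
    "t < (a + h) * (c + h)"
    using st by (auto simp: straddle_def h_def)
  have "0 < a" "0 < c" "a \<le> 1"
    using ac r_bounds basic_left_bounds[OF basic(1) r_bounds] h unfolding h_def by linarith+
  have ge: "1 - r \<le> \<alpha>" "1 - r \<le> \<gamma>" "a \<le> \<alpha>" "c \<le> \<gamma>"
    using ac h r_bounds by (auto simp: \<alpha>_def \<gamma>_def intro: order_trans)
  have child: "straddle r t (Suc n) a' c'"
    if "a' \<in> {a, \<alpha>}" "c' \<in> {c, \<gamma>}" "a' * c' < t" "t < (a' + r * h) * (c' + r * h)" for a' c'
    using that basic ac ge basic_left.left basic_left.right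
    by (auto simp: straddle_def \<alpha>_def \<gamma>_def h_def)
  have top: "\<alpha> + r * h = a + h" "\<gamma> + r * h = c + h"
    by (auto simp: \<alpha>_def \<gamma>_def algebra_simps)
  \<comment> \<open>From \<open>a \<le> 1\<close> and \<open>1 - r \<le> c\<close> comes
    \<open>ratio\<close>, the first-order part in \<open>h\<close> of both overlaps below; their
    second-order parts are nonnegative.\<close>
  have "(1 - r) * a \<le> 1 - r"
    using \<open>a \<le> 1\<close> r_bounds by (intro mult_left_le) auto
  then have "(1 - r) * a \<le> c"
    using ac(2) by linarith
  then have "r * ((1 - r) * a) \<le> r * c"
    using r_bounds by simp
  moreover have "(1 - 2 * r) * a < r * (1 - r) * a"
    using r_quadratic(2) \<open>0 < a\<close> by simp
  ultimately have ratio: "(1 - 2 * r) * a < r * c"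
    by (simp add: algebra_simps)
  then have ratio_h: "h * ((1 - 2 * r) * a) < h * (r * c)"
    using h by simp
  have meet_00_01: "a * \<gamma> < (a + r * h) * (c + r * h)"
  proof -
    have "(a + r * h) * (c + r * h) - a * \<gamma> = h * (r * c) - h * ((1 - 2 * r) * a) + (r * h)\<^sup>2"
      by (simp add: \<gamma>_def algebra_simps power2_eq_square)
    then show ?thesis
      using ratio_h zero_le_power2[of "r * h"] by linarith
  qed
  have meet_10_11: "\<alpha> * \<gamma> < (a + h) * (c + r * h)"
  proof -
    have "(a + h) * (c + r * h) - \<alpha> * \<gamma> = h * (r * c) - h * ((1 - 2 * r) * a) + (r - (1 - r)\<^sup>2) * h\<^sup>2"
      by (simp add: \<alpha>_def \<gamma>_def algebra_simps power2_eq_square)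
    moreover have "0 \<le> (r - (1 - r)\<^sup>2) * h\<^sup>2"
      using r_quadratic(1) by simp
    ultimately show ?thesis
      using ratio_h by linarith
  qed
  have lower': "\<alpha> * c < t" and upper': "t < (a + r * h) * (c + h)"
    using lower upper by (auto simp: \<alpha>_def h_def)
  have ord: "(a + r * h) * (c + r * h) \<le> (a + h) * (c + r * h)"
    using h r_bounds \<open>0 < c\<close> by (intro mult_right_mono) auto
  have sub: "square r (Suc n) a' c' \<subseteq> square r n a c" if "a' \<in> {a, \<alpha>}" "c' \<in> {c, \<gamma>}" for a' c'
    using that by (intro square_children_subset) (auto simp: \<alpha>_def \<gamma>_def h_def)
  have disj: "square r (Suc n) a c' \<inter> square r (Suc n) \<alpha> c'' = {}" for c' c''
    unfolding \<alpha>_def h_def by (rule square_children_disjoint)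
  \<comment> \<open>Cutting at the right endpoints of the images of 00 and 10 puts \<open>t\<close>
    into 00 and 10, into 01 and 10, or into 01 and 11. Each pair differs in the first digit, so
    \<open>disj\<close> applies.\<close>
  consider "t < (a + r * h) * (c + r * h)"
    | "(a + r * h) * (c + r * h) \<le> t" "t < (a + h) * (c + r * h)" | "(a + h) * (c + r * h) \<le> t"
    by linarith
  then show ?thesis
  proof cases
    case 1
    have "straddle r t (Suc n) a c" "straddle r t (Suc n) \<alpha> c"
      using 1 ac lower' ord by (auto intro!: child simp: top)
    then show ?thesis
      unfolding splits_def using sub disj by blast
  next
    case 2
    have "straddle r t (Suc n) a \<gamma>" "straddle r t (Suc n) \<alpha> c"
      using 2 meet_00_01 lower' upper' by (auto intro!: child simp: top)
    then show ?thesis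
      unfolding splits_def using sub disj by blast
  next
    case 3
    have "straddle r t (Suc n) a \<gamma>" "straddle r t (Suc n) \<alpha> \<gamma>"
      using 3 meet_00_01 meet_10_11 ord upper' ac by (auto intro!: child simp: top)
    then show ?thesis
      unfolding splits_def using sub disj by blast
  qed
qed

text \<open>Used with \<open>x\<close> the distance from \<open>t\<close> to a corner value:
  \<open>m\<close> is the first level at which \<open>t\<close> clears the threshold next to that
  corner, and failure one level earlier keeps \<open>t\<close> from being too far away.\<close>

lemma first_power_below:
  fixes x y :: real
  assumes "0 < x" "x \<le> y * r ^ n"
  obtains m where "0 < m" "y * r ^ (n + m) < x" "x \<le> y * r ^ (n + m - 1)"
proof -
  have "(\<lambda>m. y * r ^ n * r ^ m) \<longlonglongrightarrow> y * r ^ n * 0"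
    using r_bounds by (intro tendsto_mult_left LIMSEQ_power_zero) auto
  then have "eventually (\<lambda>m. y * r ^ n * r ^ m < x) sequentially"
    using assms(1) by (auto dest: order_tendstoD)
  then have ex: "\<exists>m. y * r ^ (n + m) < x"
    by (auto simp: eventually_sequentially power_add mult.assoc)
  define m where "m = (LEAST m. y * r ^ (n + m) < x)"
  have m: "y * r ^ (n + m) < x"
    using LeastI_ex[OF ex] by (simp add: m_def)
  have "m \<noteq> 0"
    using m assms(2) by (intro notI) simp
  moreover have "x \<le> y * r ^ (n + (m - 1))"
    using not_less_Least[of "m - 1" "\<lambda>m. y * r ^ (n + m) < x"] \<open>m \<noteq> 0\<close> by (simp add: m_def)
  ultimately show thesis
    using m that[of m] by simp
qed

lemma splits_near_minimum:
  assumes st: "straddle r t n a c" and "c \<le> a" and low: "t \<le> (a + (1 - r) * r ^ n) * c"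
  shows "splits r t n a c"
proof -
  have basic: "basic_left r n a" "basic_left r n c" and ac: "1 - r \<le> a" "1 - r \<le> c" "a * c < t"
    using st by (auto simp: straddle_def)
  have "0 < c" using ac r_bounds by auto
  have "t - a * c \<le> ((1 - r) * c) * r ^ n"
    using low by (simp add: algebra_simps)
  then obtain m where m: "0 < m" "((1 - r) * c) * r ^ (n + m) < t - a * c"
    "t - a * c \<le> ((1 - r) * c) * r ^ (n + m - 1)"
    using first_power_below ac(3) by (metis diff_gt_0_iff_gt)
  define h where "h = r ^ (n + m - 1)"
  have h: "0 < h" using r_bounds by (simp add: h_def)
  have pow: "r ^ (n + m) = r * h"
    using m(1) by (simp add: h_def power_eq_if)
  \<comment> \<open>The threshold one level up is \<open>h * ((1 - r) * c)\<close>. It must stay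
    below the far end of the inner region at side \<open>r * h\<close>, whose distance from
    \<open>a * c\<close> is \<open>h * (r * a + r\<^sup>2 * c) + r ^ 3 * h\<^sup>2\<close>.\<close>
  have "(1 - r) * c < (r + r\<^sup>2) * c"
    using r_quadratic(3) \<open>0 < c\<close> by simp
  also have "\<dots> \<le> r * a + r\<^sup>2 * c"
    using \<open>c \<le> a\<close> r_bounds by (simp add: algebra_simps)
  finally have "h * ((1 - r) * c) < h * (r * a + r\<^sup>2 * c)"
    using h by simp
  moreover have "0 \<le> r ^ 3 * h\<^sup>2"
    using r_bounds by simp
  ultimately have up: "t < (a + r * r ^ (n + m)) * (c + r ^ (n + m))"
    using m(3) unfolding pow h_def[symmetric]
    by (simp add: algebra_simps power2_eq_square power3_eq_cube)
  have mono: "(a + r * r ^ (n + m)) * (c + r ^ (n + m)) \<le> (a + r ^ (n + m)) * (c + r ^ (n + m))"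
    using r_bounds \<open>0 < c\<close> by (intro mult_right_mono) (auto simp: mult_left_le_one_le)
  have "straddle r t (n + m) a c"
    using basic ac up mono by (auto simp: straddle_def basic_left_left_corner)
  then have "splits r t (n + m) a c"
    using m(2) up \<open>c \<le> a\<close> by (intro splits_inner) (auto simp: algebra_simps)
  moreover have "r ^ (n + m) \<le> r ^ n"
    using r_bounds by (intro power_decreasing) auto
  then have "square r (n + m) a c \<subseteq> square r n a c"
    by (auto simp: square_def)
  ultimately show ?thesis
    using splits_mono by auto
qed

text \<open>The mirror image of the descent at the minimum, at the upper corner
  \<open>(b, d)\<close>. The quadratic term now has the wrong sign and must be absorbed.\<close>

lemma splits_near_maximum:
  assumes st: "straddle r t n a c" and "c \<le> a" and high: "(a + r * r ^ n) * (c + r ^ n) \<le> t"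
  shows "splits r t n a c"
proof -
  define b where "b = a + r ^ n"
  define d where "d = c + r ^ n"
  have basic: "basic_left r n a" "basic_left r n c" and ac: "1 - r \<le> a" "1 - r \<le> c" "t < b * d"
    using st by (auto simp: straddle_def b_def d_def)
  have rn: "0 < r ^ n" using r_bounds by simp
  have "0 < d" "d \<le> b" "d \<le> 1"
    using ac r_bounds rn \<open>c \<le> a\<close> basic_left_bounds[OF basic(2) r_bounds] by (auto simp: b_def d_def)
  have "b * d - t \<le> ((1 - r) * d) * r ^ n"
    using high by (simp add: b_def d_def algebra_simps)
  then obtain m where m: "0 < m" "((1 - r) * d) * r ^ (n + m) < b * d - t"
    "b * d - t \<le> ((1 - r) * d) * r ^ (n + m - 1)"
    using first_power_below ac(3) by (metis diff_gt_0_iff_gt)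
  define h where "h = r ^ (n + m - 1)"
  have h: "0 < h" using r_bounds by (simp add: h_def)
  have pow: "r ^ (n + m) = r * h"
    using m(1) by (simp add: h_def power_eq_if)
  have "h \<le> r ^ n"
    unfolding h_def using r_bounds m(1) by (intro power_decreasing) auto
  then have hd: "h \<le> d - (1 - r)"
    using ac by (simp add: d_def)
  \<comment> \<open>The side is bounded through \<open>c \<ge> 1 - r\<close> and
    \<open>d \<le> 1\<close> by \<open>h \<le> d - (1 - r) \<le> r * d\<close>, which turns the
    cubic term into \<open>r ^ 4 * d\<close>.\<close>
  have key: "r ^ 3 * h < (r\<^sup>2 + 2 * r - 1) * d"
  proof -
    have "d - (1 - r) \<le> r * d"
      using mult_left_mono[of d 1 "1 - r"] \<open>d \<le> 1\<close> r_bounds by (simp add: algebra_simps)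
    then have "r ^ 3 * h \<le> r ^ 3 * (r * d)"
      using hd r_bounds by (intro mult_left_mono) auto
    also have "\<dots> = r ^ 4 * d"
      by (simp add: power4_eq_xxxx power3_eq_cube)
    also have "\<dots> < (r\<^sup>2 + 2 * r - 1) * d"
      using r_quadratic(4) \<open>0 < d\<close> by simp
    finally show ?thesis .
  qed
  have "r * d \<le> r * b"
    using \<open>d \<le> b\<close> r_bounds by simp
  then have "(1 - r) * d + r ^ 3 * h < r * b + r\<^sup>2 * d"
    using key by (simp add: algebra_simps)
  then have "h * ((1 - r) * d + r ^ 3 * h) < h * (r * b + r\<^sup>2 * d)"
    using h by simp
  then have low: "(b - r * r ^ (n + m)) * (d - r ^ (n + m)) < t"
    using m(3) unfolding pow h_def[symmetric]
    by (simp add: algebra_simps power2_eq_square power3_eq_cube)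
  define a' where "a' = b - r ^ (n + m)"
  define c' where "c' = d - r ^ (n + m)"
  have le: "r ^ (n + m) \<le> r ^ n"
    using r_bounds by (intro power_decreasing) auto
  then have ge: "a \<le> a'" "c \<le> c'"
    by (auto simp: a'_def c'_def b_def d_def)
  have mono: "a' * c' \<le> (b - r * r ^ (n + m)) * c'"
    unfolding a'_def using ge ac r_bounds by (intro mult_right_mono) (auto simp: mult_left_le_one_le)
  have "straddle r t (n + m) a' c'"
    using basic basic_left_right_corner[of r n _ m] ac ge low mono
    by (auto simp: straddle_def a'_def c'_def b_def d_def)
  moreover have "(a' + (1 - r) * r ^ (n + m)) * c' < t"
    using low by (simp add: a'_def c'_def algebra_simps)
  moreover have "t < (a' + r * r ^ (n + m)) * (c' + r ^ (n + m))"
    using m(2) by (simp add: a'_def c'_def algebra_simps)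
  moreover have "c' \<le> a'"
    using \<open>d \<le> b\<close> by (simp add: a'_def c'_def)
  ultimately have "splits r t (n + m) a' c'"
    by (intro splits_inner)
  moreover have "square r (n + m) a' c' \<subseteq> square r n a c"
    using ge by (auto simp: square_def a'_def c'_def b_def d_def)
  ultimately show ?thesis
    using splits_mono by auto
qed

text \<open>Swapping coordinates gives \<open>c \<le> a\<close>; then \<open>t\<close> lies in the
  inner region or on one side of it.\<close>

lemma straddle_splits:
  assumes "straddle r t n a c"
  shows "splits r t n a c"
proof -
  have "splits r t n a c" if "straddle r t n a c" "c \<le> a" for a c
    using splits_inner splits_near_minimum splits_near_maximum that by (meson not_le)
  then show ?thesis
    using assms straddle_commute splits_commute by (metis linear)
qed

lemma straddle_descend:
  assumes "straddle r t n a c"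
  shows "\<exists>m\<ge>k. \<exists>a' c'. straddle r t m a' c' \<and> square r m a' c' \<subseteq> square r n a c"
proof (induction k)
  case 0
  then show ?case using assms by blast
next
  case (Suc k)
  then obtain m a' c' where "k \<le> m" "straddle r t m a' c'" "square r m a' c' \<subseteq> square r n a c"
    by blast
  moreover obtain l a1 c1 where "m < l" "straddle r t l a1 c1" "square r l a1 c1 \<subseteq> square r m a' c'"
    using straddle_splits[OF \<open>straddle r t m a' c'\<close>] unfolding splits_def by blast
  ultimately show ?case
    by (meson Suc_leI le_less_trans subset_trans)
qed

section \<open>Solutions inside a straddling square\<close>

definition solutions :: "nat \<Rightarrow> real \<Rightarrow> real \<Rightarrow> (real \<times> real) set" where
  "solutions n a c =
     {(x, y) \<in> middle_cantor r \<times> middle_cantor r. x * y = t} \<inter> square r n a c"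

lemma compact_cantor_square: "compact ((middle_cantor r \<times> middle_cantor r) \<inter> square r n a c)"
  unfolding square_def
  by (intro compact_Int compact_Times compact_middle_cantor r_bounds compact_Icc)

lemma compact_solutions: "compact (solutions n a c)"
proof -
  have "closed {p :: real \<times> real. fst p * snd p = t}"
    by (intro closed_Collect_eq continuous_intros)
  then have "compact ((middle_cantor r \<times> middle_cantor r) \<inter> square r n a c \<inter> {p. fst p * snd p = t})"
    by (intro compact_Int_closed compact_cantor_square)
  moreover have "\<dots> = solutions n a c"
    by (auto simp: solutions_def)
  ultimately show ?thesis by simp
qed

text \<open>The products over a compact set form a closed set, and \<open>t\<close> is a limit of
  products of lower left corners of ever smaller straddling squares; these corners are Cantor
  points.\<close>

lemma solutions_nonempty:
  assumes "straddle r t n a c"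
  shows "solutions n a c \<noteq> {}"
proof -
  let ?Q = "(middle_cantor r \<times> middle_cantor r) \<inter> square r n a c"
  let ?P = "(\<lambda>p. fst p * snd p) ` ?Q"
  have "compact ?P"
    by (intro compact_continuous_image compact_cantor_square continuous_intros)
  then have "closed ?P" by (rule compact_imp_closed)
  moreover have "\<exists>y\<in>?P. dist y t < e" if "0 < e" for e
  proof -
    \<comment> \<open>On a square of side \<open>h\<close> inside the unit square, products vary by
      at most \<open>h * a' + h * c' + h * h \<le> 3 * h\<close>.\<close>
    obtain k where "r ^ k < e / 3"
      using real_arch_pow_inv[of "e / 3" r] \<open>0 < e\<close> r_bounds by auto
    then have k: "3 * r ^ m < e" if "k \<le> m" for m
      using power_decreasing[OF that, of r] r_bounds by linarith
    obtain m a' c' where m: "k \<le> m" and st: "straddle r t m a' c'"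
      and sub: "square r m a' c' \<subseteq> square r n a c"
      using straddle_descend[OF assms] by blast
    define h where "h = r ^ m"
    have h: "0 < h" "h \<le> 1" using r_bounds by (auto simp: h_def power_le_one)
    have "basic_left r m a'" "basic_left r m c'"
      using st by (auto simp: straddle_def)
    then have "a' \<in> middle_cantor r" "c' \<in> middle_cantor r" "a' + h \<le> 1" "c' + h \<le> 1"
      using basic_left_in_middle_cantor basic_left_bounds[OF _ r_bounds] by (auto simp: h_def)
    moreover from this have "a' \<le> 1" "c' \<le> 1"
      using h by auto
    moreover have "(a', c') \<in> square r m a' c'"
      using h by (auto simp: square_def h_def)
    ultimately have "(a', c') \<in> ?Q"
      using sub by auto
    moreover have "dist (a' * c') t < e"
    proof -
      have "h * a' \<le> h" "h * c' \<le> h" "h * h \<le> h"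
        using h \<open>a' \<le> 1\<close> \<open>c' \<le> 1\<close> by (auto simp: mult_left_le)
      then have "(a' + h) * (c' + h) \<le> a' * c' + 3 * h"
        by (simp add: algebra_simps)
      moreover have "a' * c' < t" "t < (a' + h) * (c' + h)"
        using st by (auto simp: straddle_def h_def)
      moreover have "3 * h < e"
        using k[OF m] by (simp add: h_def)
      ultimately show ?thesis
        by (simp add: dist_real_def)
    qed
    ultimately show ?thesis by force
  qed
  ultimately have "t \<in> ?P"
    by (meson closed_approachable)
  then show ?thesis
    by (auto simp: solutions_def)
qed

lemma reals_lepoll_solutions:
  assumes "straddle r t n a c"
  shows "(UNIV :: real set) \<lesssim> solutions n a c"
proof (rule lepoll_compact_splitting)
  let ?\<K> = "{solutions n a c | n a c. straddle r t n a c}"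
  show "solutions n a c \<in> ?\<K>" using assms by blast
  fix K assume "K \<in> ?\<K>"
  then obtain n a c where K: "K = solutions n a c" and st: "straddle r t n a c"
    by blast
  show "compact K" "K \<noteq> {}"
    using K st compact_solutions solutions_nonempty by auto
  obtain m a1 c1 a2 c2 where *: "straddle r t m a1 c1" "straddle r t m a2 c2"
     "square r m a1 c1 \<subseteq> square r n a c" "square r m a2 c2 \<subseteq> square r n a c"
     "square r m a1 c1 \<inter> square r m a2 c2 = {}"
    using straddle_splits[OF st] unfolding splits_def by blast
  have "solutions m a1 c1 \<subseteq> K" "solutions m a2 c2 \<subseteq> K"
    "solutions m a1 c1 \<inter> solutions m a2 c2 = {}"
    using *(3-5) unfolding K solutions_def by blast+
  then show "\<exists>K1\<in>?\<K>. \<exists>K2\<in>?\<K>. K1 \<subseteq> K \<and> K2 \<subseteq> K \<and> K1 \<inter> K2 = {}"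
    using *(1,2) by blast
qed

text \<open>The tree starts at the square over \<open>[1 - r, 1]\<close>, whose extreme products are
  \<open>(1 - r)\<^sup>2 < r\<close> and 1.\<close>

lemma reals_lepoll_products:
  assumes "r \<le> t" "t < 1"
  shows "(UNIV :: real set) \<lesssim> {(x, y) \<in> middle_cantor r \<times> middle_cantor r. x * y = t}"
proof -
  have "basic_left r 1 (1 - r)"
    using basic_left.right[OF basic_left.zero, of r] by simp
  moreover have "(1 - r) * (1 - r) < t"
    using r_quadratic(1) assms by (simp add: power2_eq_square)
  ultimately have "straddle r t 1 (1 - r) (1 - r)"
    using assms by (simp add: straddle_def)
  then have "(UNIV :: real set) \<lesssim> solutions 1 (1 - r) (1 - r)"
    by (rule reals_lepoll_solutions)
  then show ?thesis
    by (rule lepoll_trans) (simp add: solutions_def subset_imp_lepoll)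
qed

end

theorem theorem1p1:
  fixes r t :: real
  assumes "0.4302 \<le> r" and "r < 1 / 2"
    and "0 < t" and "t < 1"
  shows "{(x, y) \<in> middle_cantor r \<times> middle_cantor r. x * y = t} \<approx> (UNIV :: real set)"
proof (rule lepoll_antisym)
  let ?S = "\<lambda>t. {(x, y) \<in> middle_cantor r \<times> middle_cantor r. x * y = t}"
  have r: "0 < r" "r < 1" using assms by auto
  \<comment> \<open>As \<open>t\<close> is nonzero, \<open>x\<close> determines \<open>y\<close>,
    which bounds the cardinality from above.\<close>
  have "inj_on fst (?S t)"
  proof (rule inj_onI)
    fix p q assume "p \<in> ?S t" "q \<in> ?S t" "fst p = fst q"
    moreover from this have "fst p \<noteq> 0" "fst p * snd p = fst p * snd q"
      using assms(3) by auto
    ultimately show "p = q"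
      by (simp add: prod_eq_iff)
  qed
  then show "?S t \<lesssim> (UNIV :: real set)"
    by (auto simp: lepoll_def)
  \<comment> \<open>This \<open>k\<close> brings \<open>t / r ^ k\<close> into
    \<open>[r, 1)\<close>; it is the predecessor of the least exponent with
    \<open>r ^ k \<le> t\<close>. Scaling the first coordinate by \<open>r ^ k\<close> then carries
    solutions back.\<close>
  obtain k where k: "r ^ Suc k \<le> t" "t < r ^ k"
  proof -
    have ex: "\<exists>k. r ^ k \<le> t"
      using real_arch_pow_inv[OF assms(3) r(2)] by (auto intro: less_imp_le)
    define k where "k = (LEAST k. r ^ k \<le> t)"
    have "r ^ k \<le> t"
      unfolding k_def using ex by (rule LeastI_ex)
    moreover have "k \<noteq> 0"
      using \<open>r ^ k \<le> t\<close> assms(4) by (intro notI) simp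
    moreover have "t < r ^ (k - 1)"
      using not_less_Least[of "k - 1" "\<lambda>k. r ^ k \<le> t"] \<open>k \<noteq> 0\<close> by (simp add: k_def)
    ultimately show thesis
      using that[of "k - 1"] by simp
  qed
  have "r \<le> t / r ^ k" "t / r ^ k < 1"
    using k r by (auto simp: field_simps)
  then have "(UNIV :: real set) \<lesssim> ?S (t / r ^ k)"
    using assms by (intro reals_lepoll_products)
  moreover have "?S (t / r ^ k) \<lesssim> ?S t"
    unfolding lepoll_def
  proof (intro exI conjI)
    show "inj_on (\<lambda>(x, y). (r ^ k * x, y)) (?S (t / r ^ k))"
      using r by (auto simp: inj_on_def)
    show "(\<lambda>(x, y). (r ^ k * x, y)) ` ?S (t / r ^ k) \<subseteq> ?S t"
      using r by (auto simp: middle_cantor_scale_power mult.assoc)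
  qed
  ultimately show "(UNIV :: real set) \<lesssim> ?S t"
    by (rule lepoll_trans)
qed

end
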